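(* Let $d \geq 1$ and let $\mu$ be any non-negative normalized Borel measure on $[0,1]^d$. Then for any integer $N \geq 1$ there exist points $x_1, \dots, x_N \in [0,1]^d$ such that $$ D_N^*(x_1, \dots, x_N;\mu) \leq 63 \sqrt{d}\, \frac{ \left(2 + \log_2 N \right)^{(3d+1)/2}}{N}. $$
   Context: For points $x_1,\dots,x_N\in[0,1]^d$ and a non-negative normalized Borel measure $\mu$ on $[0,1]^d$, the star-discrepancy with respect to $\mu$ is $$D_N^*(x_1, \dots, x_N;\mu) = \sup_{A} \left| \frac{1}{N} \sum_{n=1}^N \mathbf{1}_A (x_n) - \mu(A) \right|,$$ where the supremum is over all axis-parallel boxes $A=\prod_{s=1}^d[0,a_s]\subset[0,1]^d$ having one vertex at the origin. $\log_2$ denotes the binary logarithm. *)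

theory Defs
  imports "HOL-Probability.Probability"
begin

abbreviation unit_cube :: "(real ^ 'd) set" where
  "unit_cube \<equiv> cbox 0 1"

definition anchored_boxes :: "(real ^ 'd) set set" where
  "anchored_boxes = {cbox 0 a | a. a \<in> unit_cube}"

definition star_discrepancy ::
    "nat \<Rightarrow> (nat \<Rightarrow> real ^ 'd) \<Rightarrow> (real ^ 'd) measure \<Rightarrow> real" where
  "star_discrepancy N x \<mu> =
     (SUP A\<in>anchored_boxes. \<bar>(1 / real N) * (\<Sum>n=1..N. indicator A (x n)) - measure \<mu> A\<bar>)"

text \<open>
  The real-valued supremum is only meaningful for a nonempty set that is bounded above;
  the following two facts show that this is the case here.
\<close>

lemma anchored_boxes_nonempty: "anchored_boxes \<noteq> {}"
proof -
  have "cbox 0 (1 :: real ^ 'd) \<in> anchored_boxes"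
    unfolding anchored_boxes_def
    by (intro CollectI exI[of _ 1]) (auto simp: mem_box_cart)
  then show ?thesis by blast
qed

lemma bdd_above_star_discrepancy:
  fixes \<mu> :: "(real ^ 'd) measure"
  assumes "prob_space \<mu>"
  shows "bdd_above ((\<lambda>A. \<bar>(1 / real N) * (\<Sum>n=1..N. indicator A (x n)) - measure \<mu> A\<bar>)
           ` anchored_boxes)"
proof (rule bdd_aboveI2)
  fix A :: "(real ^ 'd) set"
  have "(\<Sum>n=1..N. indicator A (x n)) \<le> (\<Sum>n=1..N. (1::real))"
    by (intro sum_mono) (auto simp: indicator_def)
  moreover have "(0::real) \<le> (\<Sum>n=1..N. indicator A (x n))"
    by (intro sum_nonneg) auto
  ultimately have "0 \<le> (1 / real N) * (\<Sum>n=1..N. indicator A (x n))"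
    "(1 / real N) * (\<Sum>n=1..N. indicator A (x n)) \<le> 1"
    by (auto simp: divide_le_eq)
  moreover have "0 \<le> measure \<mu> A" "measure \<mu> A \<le> 1"
    using prob_space.prob_le_1[OF assms] by auto
  ultimately show "\<bar>(1 / real N) * (\<Sum>n=1..N. indicator A (x n)) - measure \<mu> A\<bar> \<le> 1"
    by linarith
qed

end

theory Submission
  imports Defs
begin

text \<open>
  Rounding instead of sampling: cut each axis at the $1/N$-quantiles of the marginal, which leaves at
  most $2N + 1$ levels per axis, and round $N \mu(Q)$ up or down for every cell $Q$ of the product
  partition. An anchored box differs from a union of cells by a set of measure at most $2d/N$, so
  only boxes that are unions of cells matter. Decomposing such a box into dyadic boxes writes
  its indicator on cells as an inner product $\langle w, v_Q \rangle$ of vectors of squared norm at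
  most $L^d$, where $L = 2 + \log_2 N$.

  The rounding is a derandomised Gram-Schmidt walk: move the coefficient $x_p$ of a
  pivot $v_p$, and let the other unfixed coefficients cancel the projection of $v_p$ on their
  vectors. After normalisation, the potential
  $\sum_w \exp (\langle w, \sum_i x_i v_i \rangle + 4 ((1 - x_p^2) n_A(w) + x_p^2 n_{A - p}(w)))$,
  with $n_A(w)$ the squared norm of the projection of $w$ on the span of the unfixed vectors, is
  bounded by a function that is affine along the walk, so one of the two directions does not increase
  it. Only exponential rather than Gaussian tails come out, but their error $O(d L^{d+1})$
  is already below the claimed bound.
\<close>

subsection \<open>Projections on spans of finite families\<close>

text \<open>Vectors are functions seen only through their coordinates in \<open>B\<close>. The form
  is positive semidefinite: a function that vanishes on \<open>B\<close> has norm 0.\<close>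

definition dotp :: "'b set \<Rightarrow> ('b \<Rightarrow> real) \<Rightarrow> ('b \<Rightarrow> real) \<Rightarrow> real" where
  "dotp B f g = (\<Sum>b\<in>B. f b * g b)"

lemma dotp_commute: "dotp B f g = dotp B g f"
  by (simp add: dotp_def mult.commute)

lemma dotp_diff_left: "dotp B (\<lambda>b. f b - g b) h = dotp B f h - dotp B g h"
  by (simp add: dotp_def left_diff_distrib sum_subtractf)

lemma dotp_scale_left: "dotp B (\<lambda>b. c * f b) h = c * dotp B f h"
  by (simp add: dotp_def sum_distrib_left mult.assoc)

lemma dotp_sum_left: "dotp B (\<lambda>b. \<Sum>i\<in>A. f i b) h = (\<Sum>i\<in>A. dotp B (f i) h)"
  by (simp add: dotp_def sum_distrib_right sum.swap[of _ A])

lemma dotp_diff_right: "dotp B h (\<lambda>b. f b - g b) = dotp B h f - dotp B h g"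
  by (simp add: dotp_def right_diff_distrib sum_subtractf)

lemma dotp_scale_right: "dotp B h (\<lambda>b. c * f b) = c * dotp B h f"
  by (simp add: dotp_def sum_distrib_left mult_ac)

lemma dotp_sum_right: "dotp B h (\<lambda>b. \<Sum>i\<in>A. f i b) = (\<Sum>i\<in>A. dotp B h (f i))"
  by (simp add: dotp_def sum_distrib_left sum.swap[of _ A])

lemmas dotp_simps = dotp_diff_left dotp_scale_left dotp_sum_left
  dotp_diff_right dotp_scale_right dotp_sum_right

lemma dotp_self_nonneg: "0 \<le> dotp B f f"
  by (simp add: dotp_def sum_nonneg)

lemma dotp_self_eq_0:
  assumes "finite B" "dotp B f f = 0"
  shows "dotp B g f = 0"
proof -
  have "\<forall>b\<in>B. f b * f b = 0"
    using assms by (simp add: dotp_def sum_nonneg_eq_0_iff)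
  then show ?thesis by (simp add: dotp_def)
qed

definition lincomb :: "'i set \<Rightarrow> ('i \<Rightarrow> real) \<Rightarrow> ('i \<Rightarrow> 'b \<Rightarrow> real) \<Rightarrow> 'b \<Rightarrow> real" where
  "lincomb A u v b = (\<Sum>i\<in>A. u i * v i b)"

lemma dotp_lincomb_right: "dotp B h (lincomb A u v) = (\<Sum>i\<in>A. u i * dotp B h (v i))"
  unfolding lincomb_def[abs_def] by (simp add: dotp_simps)

text \<open>One Gram-Schmidt step per element. The vector \<open>z\<close> is generalised because
  the step uses the hypothesis twice, for \<open>z\<close> and for the new vector
  \<open>v k\<close>, and then removes from the residual of \<open>z\<close> its component along the
  residual of \<open>v k\<close>.\<close>

lemma orthogonal_residual_exists:
  assumes "finite A" "finite B"
  shows "\<exists>u. \<forall>j\<in>A. dotp B (\<lambda>b. z b - lincomb A u v b) (v j) = 0"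
  using assms(1)
proof (induction A arbitrary: z rule: finite_induct)
  case empty
  then show ?case by simp
next
  case (insert k A)
  obtain u where u: "\<forall>j\<in>A. dotp B (\<lambda>b. z b - lincomb A u v b) (v j) = 0"
    using insert.IH by blast
  obtain u' where u': "\<forall>j\<in>A. dotp B (\<lambda>b. v k b - lincomb A u' v b) (v j) = 0"
    using insert.IH by blast
  define r where "r = (\<lambda>b. z b - lincomb A u v b)"
  define q where "q = (\<lambda>b. v k b - lincomb A u' v b)"
  \<comment> \<open>If \<open>q\<close> has norm 0, division by zero gives \<open>c = 0\<close>,
    which is harmless: every vector is then orthogonal to \<open>q\<close>.\<close>
  define c where "c = dotp B r q / dotp B q q"
  define u'' where "u'' = (\<lambda>i. if i = k then c else u i - c * u' i)"
  have eq: "(\<lambda>b. z b - lincomb (insert k A) u'' v b) = (\<lambda>b. r b - c * q b)"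
  proof
    fix b
    have "lincomb (insert k A) u'' v b = c * v k b + (\<Sum>i\<in>A. u'' i * v i b)"
      using insert.hyps by (simp add: lincomb_def u''_def)
    also have "(\<Sum>i\<in>A. u'' i * v i b) = (\<Sum>i\<in>A. u i * v i b - c * (u' i * v i b))"
      using insert.hyps by (intro sum.cong) (auto simp: u''_def algebra_simps)
    also have "\<dots> = lincomb A u v b - c * lincomb A u' v b"
      by (simp add: lincomb_def sum_subtractf sum_distrib_left)
    finally show "z b - lincomb (insert k A) u'' v b = r b - c * q b"
      by (simp add: r_def q_def algebra_simps)
  qed
  have A: "dotp B (\<lambda>b. r b - c * q b) (v j) = 0" if "j \<in> A" for j
    using that u u' by (simp add: dotp_diff_left dotp_scale_left r_def q_def)
  \<comment> \<open>The sum is written as a difference so that the rules for \<open>dotp\<close> of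
    differences and multiples apply.\<close>
  have vk: "v k = (\<lambda>b. q b - (- 1) * lincomb A u' v b)"
    by (auto simp: q_def)
  have "dotp B (\<lambda>b. r b - c * q b) q = 0"
  proof (cases "dotp B q q = 0")
    case True
    then show ?thesis using dotp_self_eq_0[OF assms(2)] by blast
  next
    case False
    then have "c * dotp B q q = dotp B r q" by (simp add: c_def)
    then show ?thesis by (simp only: dotp_diff_left dotp_scale_left)
  qed
  moreover have "dotp B (\<lambda>b. r b - c * q b) (lincomb A u' v) = 0"
    using A by (simp add: dotp_lincomb_right)
  ultimately have "dotp B (\<lambda>b. r b - c * q b) (v k) = 0"
    by (subst vk) (simp only: dotp_diff_right dotp_scale_right)
  then show ?case using A eq by (intro exI[of _ u'']) auto
qed

text \<open>For finite \<open>A\<close> this is the squared distance from \<open>w\<close> to the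
  span of the \<open>v i\<close> with \<open>i \<in> A\<close>, so
  \<open>dotp B w w - resid B v A w\<close> is the squared norm of the projection of
  \<open>w\<close>. As an infimum it involves no choice of a minimiser.\<close>

definition resid :: "'b set \<Rightarrow> ('i \<Rightarrow> 'b \<Rightarrow> real) \<Rightarrow> 'i set \<Rightarrow> ('b \<Rightarrow> real) \<Rightarrow> real" where
  "resid B v A w = (INF u. dotp B (\<lambda>b. w b - lincomb A u v b) (\<lambda>b. w b - lincomb A u v b))"

lemma resid_le: "resid B v A w \<le> dotp B (\<lambda>b. w b - lincomb A u v b) (\<lambda>b. w b - lincomb A u v b)"
  unfolding resid_def
  by (intro cINF_lower bdd_belowI2[of _ 0]) (auto simp: dotp_self_nonneg)

lemma resid_geI:
  assumes "\<And>u. c \<le> dotp B (\<lambda>b. w b - lincomb A u v b) (\<lambda>b. w b - lincomb A u v b)"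
  shows "c \<le> resid B v A w"
  unfolding resid_def using assms by (intro cINF_greatest) auto

lemma resid_nonneg: "0 \<le> resid B v A w"
  by (intro resid_geI dotp_self_nonneg)

lemma resid_le_self: "resid B v A w \<le> dotp B w w"
  using resid_le[of B v A w "\<lambda>_. 0"] by (simp add: lincomb_def)

lemma resid_antimono:
  assumes "finite A" "A' \<subseteq> A"
  shows "resid B v A w \<le> resid B v A' w"
proof (rule resid_geI)
  fix u
  have "lincomb A (\<lambda>i. if i \<in> A' then u i else 0) v = lincomb A' u v"
  proof
    fix b
    show "lincomb A (\<lambda>i. if i \<in> A' then u i else 0) v b = lincomb A' u v b"
      unfolding lincomb_def
      by (rule sum.mono_neutral_cong_right) (use assms in auto)
  qed
  then show "resid B v A w \<le> dotp B (\<lambda>b. w b - lincomb A' u v b) (\<lambda>b. w b - lincomb A' u v b)"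
    using resid_le[of B v A w "\<lambda>i. if i \<in> A' then u i else 0"] by simp
qed

text \<open>The residual \<open>q\<close> of \<open>v p\<close> has squared norm at most 1, since
  \<open>v p\<close> is the orthogonal sum of \<open>q\<close> and a vector of the span. Subtracting
  \<open>\<eta> * q\<close> from any approximation error over \<open>A\<close> therefore lowers its
  squared norm by at least \<eta> squared. In the walk this pays for the squared step.\<close>

lemma resid_insert:
  assumes A: "finite A" "p \<notin> A"
    and orth: "\<forall>j\<in>A. dotp B (\<lambda>b. v p b - lincomb A u v b) (v j) = 0"
    and le1: "dotp B (v p) (v p) \<le> 1"
  shows "(dotp B w (\<lambda>b. v p b - lincomb A u v b))\<^sup>2 \<le> resid B v A w - resid B v (insert p A) w"
proof -
  define q where "q = (\<lambda>b. v p b - lincomb A u v b)"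
  define \<eta> where "\<eta> = dotp B w q"
  have q_lin: "dotp B q (lincomb A u' v) = 0" for u'
    using orth by (simp add: dotp_lincomb_right q_def)
  have vp: "v p = (\<lambda>b. q b - (- 1) * lincomb A u v b)"
    by (auto simp: q_def)
  have "dotp B (v p) (v p) = dotp B q q + dotp B (lincomb A u v) (lincomb A u v)"
  proof -
    have "dotp B (\<lambda>b. q b - (- 1) * lincomb A u v b) (\<lambda>b. q b - (- 1) * lincomb A u v b)
        = dotp B q q + dotp B (lincomb A u v) (lincomb A u v)"
      unfolding dotp_diff_left dotp_scale_left dotp_diff_right dotp_scale_right q_lin
        dotp_commute[of B "lincomb A u v" q] by simp
    then show ?thesis using vp by metis
  qed
  then have qq: "dotp B q q \<le> 1"
    using le1 dotp_self_nonneg[of B "lincomb A u v"] by linarith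
  have "resid B v (insert p A) w + \<eta>\<^sup>2 \<le> resid B v A w"
  proof (rule resid_geI)
    fix u'
    define y where "y = (\<lambda>b. w b - lincomb A u' v b)"
    define u'' where "u'' = (\<lambda>i. if i = p then \<eta> else u' i - \<eta> * u i)"
    have eq: "(\<lambda>b. w b - lincomb (insert p A) u'' v b) = (\<lambda>b. y b - \<eta> * q b)"
    proof
      fix b
      have "lincomb (insert p A) u'' v b = \<eta> * v p b + (\<Sum>i\<in>A. u'' i * v i b)"
        using A by (simp add: lincomb_def u''_def)
      also have "(\<Sum>i\<in>A. u'' i * v i b) = (\<Sum>i\<in>A. u' i * v i b - \<eta> * (u i * v i b))"
        using A by (intro sum.cong) (auto simp: u''_def algebra_simps)
      also have "\<dots> = lincomb A u' v b - \<eta> * lincomb A u v b"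
        by (simp add: lincomb_def sum_subtractf sum_distrib_left)
      finally show "w b - lincomb (insert p A) u'' v b = y b - \<eta> * q b"
        by (simp add: y_def q_def algebra_simps)
    qed
    have yq: "dotp B y q = \<eta>"
      using q_lin[of u'] by (simp add: y_def dotp_diff_left \<eta>_def dotp_commute[of B "lincomb A u' v"])
    have "resid B v (insert p A) w \<le> dotp B (\<lambda>b. y b - \<eta> * q b) (\<lambda>b. y b - \<eta> * q b)"
      using resid_le[of B v "insert p A" w u''] eq by simp
    also have "\<dots> = dotp B y y - 2 * \<eta>\<^sup>2 + \<eta>\<^sup>2 * dotp B q q"
      by (simp add: dotp_diff_left dotp_scale_left dotp_diff_right dotp_scale_right
          dotp_commute[of B q y] yq power2_eq_square algebra_simps)
    also have "\<dots> \<le> dotp B y y - \<eta>\<^sup>2"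
      using mult_left_mono[OF qq, of "\<eta>\<^sup>2"] by simp
    finally show "resid B v (insert p A) w + \<eta>\<^sup>2
        \<le> dotp B (\<lambda>b. w b - lincomb A u' v b) (\<lambda>b. w b - lincomb A u' v b)"
      by (simp add: y_def)
  qed
  then show ?thesis by (simp add: \<eta>_def q_def)
qed

subsection \<open>The Gram-Schmidt walk\<close>

text \<open>The part of the exponent linear in \<delta> is collected in \<open>z\<close>; the
  remaining quadratic part absorbs the second-order error in
  \<open>z - 2 * z^2 \<le> ln (1 + z)\<close>. The resulting bound is affine in \<delta>, which is
  what allows a direction to be chosen.\<close>

lemma exp_step_bound:
  fixes x \<delta> \<eta> W :: real
  assumes x: "\<bar>x\<bar> \<le> 1" and x\<delta>: "\<bar>x + \<delta>\<bar> \<le> 1" and \<eta>: "\<eta>\<^sup>2 \<le> W" and W: "W \<le> 1/400"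
  shows "exp (\<delta> * \<eta> - 4 * W * (2 * x * \<delta> + \<delta>\<^sup>2)) \<le> 1 + \<delta> * (\<eta> - 8 * W * x)"
proof -
  define s where "s = sqrt W"
  have "0 \<le> W" using \<eta> zero_le_power2[of \<eta>] by linarith
  then have s: "0 \<le> s" "s\<^sup>2 = W" by (auto simp: s_def)
  have s20: "s \<le> 1/20"
    using W s by (intro power2_le_imp_le[of s "1/20"]) (auto simp: power2_eq_square)
  have \<eta>s: "\<bar>\<eta>\<bar> \<le> s"
    using \<eta> s by (metis abs_le_square_iff abs_of_nonneg)
  have "\<bar>8 * W * x\<bar> \<le> 8 * W * 1"
    using x \<open>0 \<le> W\<close> by (simp add: abs_mult mult_left_le)
  also have "\<dots> = 8 * s * s" using s by (simp add: power2_eq_square)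
  also have "\<dots> \<le> 8 * (1/20) * s" using s20 s(1) by (intro mult_right_mono) auto
  \<comment> \<open>\<open>7/5 = 1 + 8/20\<close>.\<close>
  finally have k: "\<bar>\<eta> - 8 * W * x\<bar> \<le> 7/5 * s" using \<eta>s by linarith
  define z where "z = \<delta> * (\<eta> - 8 * W * x)"
  have \<delta>2: "\<bar>\<delta>\<bar> \<le> 2" using x x\<delta> by linarith
  have "\<bar>z\<bar> \<le> 2 * (7/5 * s)"
    unfolding z_def abs_mult using \<delta>2 k by (intro mult_mono) auto
  then have z: "\<bar>z\<bar> \<le> 1/2" using s20 by linarith
  have "z\<^sup>2 \<le> \<delta>\<^sup>2 * (7/5 * s)\<^sup>2"
    unfolding z_def power_mult_distrib[of \<delta>] using k s
    by (intro mult_left_mono) (auto simp: abs_le_square_iff[symmetric])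
  also have "\<dots> = 49/25 * (W * \<delta>\<^sup>2)" using s by (simp add: power_mult_distrib power2_eq_square)
  \<comment> \<open>Twice \<open>49/25\<close> is 3.92; this is where the factor 4 of the potential
    suffices.\<close>
  finally have z2: "2 * z\<^sup>2 \<le> 4 * W * \<delta>\<^sup>2"
    using mult_nonneg_nonneg[OF \<open>0 \<le> W\<close> zero_le_power2[of \<delta>]] by linarith
  have "\<delta> * \<eta> - 4 * W * (2 * x * \<delta> + \<delta>\<^sup>2) = z - 4 * W * \<delta>\<^sup>2"
    by (simp add: z_def algebra_simps)
  also have "\<dots> \<le> z - 2 * z\<^sup>2" using z2 by simp
  also have "\<dots> \<le> ln (1 + z)"
    using abs_ln_one_plus_x_minus_x_bound[OF z] by linarith
  finally have "exp (\<delta> * \<eta> - 4 * W * (2 * x * \<delta> + \<delta>\<^sup>2)) \<le> exp (ln (1 + z))" by simp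
  also have "\<dots> = 1 + z" using z by simp
  finally show ?thesis by (simp add: z_def)
qed

lemma move_to_boundary:
  fixes x u :: "'i \<Rightarrow> real"
  assumes "finite A" "p \<in> A" "u p \<noteq> 0" and x: "\<forall>i\<in>A. \<bar>x i\<bar> < 1"
  shows "\<exists>\<delta>>0. (\<forall>i\<in>A. \<bar>x i + \<delta> * u i\<bar> \<le> 1) \<and> (\<exists>i\<in>A. \<bar>x i + \<delta> * u i\<bar> = 1)"
proof -
  \<comment> \<open>\<open>t i\<close> is the time at which coordinate \<open>i\<close> leaves
    [-1, 1]; the first exit time is the one to take. The pivot guarantees that some coordinate
    moves.\<close>
  define t where "t = (\<lambda>i. (1 - sgn (u i) * x i) / \<bar>u i\<bar>)"
  define C where "C = {i\<in>A. u i \<noteq> 0}"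
  define \<delta> where "\<delta> = Min (t ` C)"
  have C: "finite C" "C \<noteq> {}" using assms by (auto simp: C_def)
  have sgnx: "sgn (u i) * x i < 1" if "i \<in> A" for i
    using x that by (auto simp: sgn_if abs_less_iff)
  have t0: "0 < t i" if "i \<in> C" for i
    using sgnx that by (auto simp: t_def C_def)
  have \<delta>0: "0 < \<delta>" unfolding \<delta>_def using C t0 by (subst Min_gr_iff) auto
  have "\<delta> \<in> t ` C" unfolding \<delta>_def using C by (intro Min_in) auto
  then obtain j where j: "j \<in> C" "\<delta> = t j" by blast
  have "\<bar>x j + \<delta> * u j\<bar> = 1"
    using j by (auto simp: t_def C_def sgn_if abs_if field_simps split: if_splits)
  moreover have "\<bar>x i + \<delta> * u i\<bar> \<le> 1" if i: "i \<in> A" for i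
  proof (cases "u i = 0")
    case True
    then show ?thesis using x i by (auto intro: less_imp_le)
  next
    case False
    then have "\<delta> \<le> t i" unfolding \<delta>_def using C i by (intro Min_le) (auto simp: C_def)
    then have *: "\<delta> * \<bar>u i\<bar> \<le> 1 - sgn (u i) * x i"
      using False by (simp add: t_def pos_le_divide_eq)
    have xi: "-1 < x i" "x i < 1" using x i by (auto simp: abs_less_iff)
    show ?thesis
    proof (cases "u i > 0")
      case True
      then have "0 \<le> \<delta> * u i" using \<delta>0 by simp
      then show ?thesis using * True xi by (simp add: abs_le_iff)
    next
      case F: False
      then have "\<delta> * u i \<le> 0" using \<delta>0 by (simp add: mult_le_0_iff)
      then show ?thesis using * F False xi by (simp add: abs_le_iff)
    qed
  qed
  ultimately show ?thesis using \<delta>0 j by (auto simp: C_def)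
qed

text \<open>Induction on the number of unfixed coefficients: each move fixes at least one more
  without increasing the potential. The pivot \<open>p\<close> is part of the statement because it
  must stay the same until it is fixed. The offsets \<open>c\<close> let the sums be centred at the
  starting point.\<close>

lemma gram_schmidt_walk:
  fixes v :: "'i \<Rightarrow> 'b \<Rightarrow> real" and w :: "'t \<Rightarrow> 'b \<Rightarrow> real"
    and x :: "'i \<Rightarrow> real" and c :: "'t \<Rightarrow> real"
  assumes fin: "finite I" "finite B" "finite T"
    and v: "\<And>i. i \<in> I \<Longrightarrow> dotp B (v i) (v i) \<le> 1"
    and w: "\<And>t. t \<in> T \<Longrightarrow> dotp B (w t) (w t) \<le> 1/400"
  defines "S \<equiv> \<lambda>t x. c t + (\<Sum>i\<in>I. x i * dotp B (w t) (v i))"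
    and "n \<equiv> \<lambda>A t. dotp B (w t) (w t) - resid B v A (w t)"
  assumes x: "\<forall>i\<in>I. \<bar>x i\<bar> \<le> 1" and A: "A = {i\<in>I. \<bar>x i\<bar> < 1}" and p: "p \<in> A"
  shows "\<exists>y. (\<forall>i\<in>I. \<bar>y i\<bar> = 1) \<and> (\<forall>i\<in>I. \<bar>x i\<bar> = 1 \<longrightarrow> y i = x i) \<and>
     (\<Sum>t\<in>T. exp (S t y))
       \<le> (\<Sum>t\<in>T. exp (S t x + 4 * ((1 - (x p)\<^sup>2) * n A t + (x p)\<^sup>2 * n (A - {p}) t)))"
  using x A p
proof (induction "card A" arbitrary: A x p rule: less_induct)
  case less
  note x = less.prems(1) and A = less.prems(2) and p = less.prems(3)
  define Q where "Q = A - {p}"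
  have finA: "finite A" "finite Q" using fin A by (auto simp: Q_def)
  have AQ: "A = insert p Q" "p \<notin> Q" using p by (auto simp: Q_def)
  have AI: "A \<subseteq> I" using A by auto
  obtain u0 where u0: "\<forall>j\<in>Q. dotp B (\<lambda>b. v p b - lincomb Q u0 v b) (v j) = 0"
    using orthogonal_residual_exists[OF finA(2) fin(2)] by blast
  \<comment> \<open>Along this direction the vector sum moves by the residual of \<open>v p\<close>
    against the other unfixed vectors.\<close>
  define u where "u = (\<lambda>i. if i = p then 1 else if i \<in> Q then - u0 i else 0)"
  define \<eta> where "\<eta> = (\<lambda>t. dotp B (w t) (\<lambda>b. v p b - lincomb Q u0 v b))"
  have n_mono: "n A1 t \<le> n A2 t" if "A1 \<subseteq> A2" "A2 \<subseteq> A" for A1 A2 t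
    using resid_antimono[of A2 A1] that finA by (auto simp: n_def intro: finite_subset)
  have n_nonneg: "0 \<le> n A1 t" for A1 t
    using resid_le_self by (auto simp: n_def)
  \<comment> \<open>The bracket in the potential is \<open>n A t - (x p)^2 * W t\<close>, so moving
    \<open>x p\<close> by \<delta> changes it by
    \<open>- W t * (2 * x p * \<delta> + \<delta>^2)\<close>, the form treated in
    \<open>exp_step_bound\<close>.\<close>
  define W where "W = (\<lambda>t. n A t - n Q t)"
  have W: "(\<eta> t)\<^sup>2 \<le> W t" for t
    using resid_insert[OF finA(2) AQ(2) u0, of "w t"] v[of p] AI p AQ
    by (auto simp: W_def n_def \<eta>_def)
  have W_le: "W t \<le> 1/400" if "t \<in> T" for t
    using w[OF that] resid_nonneg[of B v A "w t"] n_nonneg[of Q t]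
    by (auto simp: W_def n_def)
  have u_sum: "(\<Sum>i\<in>I. u i * dotp B (w t) (v i)) = \<eta> t" for t
  proof -
    have "(\<Sum>i\<in>I. u i * dotp B (w t) (v i)) = (\<Sum>i\<in>A. u i * dotp B (w t) (v i))"
      using fin AI AQ by (intro sum.mono_neutral_right) (auto simp: u_def)
    also have "\<dots> = dotp B (w t) (v p) + (\<Sum>i\<in>Q. u i * dotp B (w t) (v i))"
      using finA AQ by (simp add: u_def)
    also have "(\<Sum>i\<in>Q. u i * dotp B (w t) (v i)) = (\<Sum>i\<in>Q. - (u0 i * dotp B (w t) (v i)))"
      using AQ by (intro sum.cong) (auto simp: u_def)
    finally show ?thesis
      by (simp add: \<eta>_def dotp_diff_right dotp_lincomb_right sum_negf)
  qed
  define P where "P = (\<lambda>t. exp (S t x + 4 * ((1 - (x p)\<^sup>2) * n A t + (x p)\<^sup>2 * n Q t)))"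
  \<comment> \<open>\<open>K\<close> is the slope in \<delta> of the affine upper bound on the
    potential. Both directions reach the boundary, so the sign of \<delta> can be chosen to make
    \<open>\<delta> * K\<close> nonpositive.\<close>
  define K where "K = (\<Sum>t\<in>T. P t * (\<eta> t - 8 * W t * x p))"
  have up: "u p = 1" by (simp add: u_def)
  have xA: "\<forall>i\<in>A. \<bar>x i\<bar> < 1" using A by auto
  obtain \<delta> where \<delta>: "\<delta> * K \<le> 0" "\<forall>i\<in>A. \<bar>x i + \<delta> * u i\<bar> \<le> 1" "\<exists>i\<in>A. \<bar>x i + \<delta> * u i\<bar> = 1"
  proof (cases "K \<le> 0")
    case True
    obtain \<delta> where "\<delta> > 0" "\<forall>i\<in>A. \<bar>x i + \<delta> * u i\<bar> \<le> 1" "\<exists>i\<in>A. \<bar>x i + \<delta> * u i\<bar> = 1"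
      using move_to_boundary[OF finA(1) p _ xA, of u] up by auto
    then show ?thesis using that[of \<delta>] True by (auto simp: mult_le_0_iff)
  next
    case False
    obtain \<delta> where "\<delta> > 0" "\<forall>i\<in>A. \<bar>x i + \<delta> * - u i\<bar> \<le> 1" "\<exists>i\<in>A. \<bar>x i + \<delta> * - u i\<bar> = 1"
      using move_to_boundary[OF finA(1) p _ xA, of "\<lambda>i. - u i"] up by auto
    then show ?thesis using that[of "- \<delta>"] False by (auto simp: mult_le_0_iff)
  qed
  define x' where "x' = (\<lambda>i. x i + \<delta> * u i)"
  define A' where "A' = {i\<in>I. \<bar>x' i\<bar> < 1}"
  have x'_out: "x' i = x i" if "i \<notin> A" for i using that AQ by (auto simp: x'_def u_def)
  have x'_le: "\<forall>i\<in>I. \<bar>x' i\<bar> \<le> 1"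
    using \<delta>(2) x x'_out by (metis x'_def)
  have A'_sub: "A' \<subset> A"
  proof -
    have "A' \<subseteq> A" using x'_out A by (auto simp: A'_def)
    moreover obtain i where "i \<in> A" "\<bar>x' i\<bar> = 1" using \<delta>(3) by (auto simp: x'_def)
    ultimately show ?thesis by (auto simp: A'_def)
  qed
  have fixed: "x' i = x i" "\<bar>x' i\<bar> = 1" if "i \<in> I" "\<bar>x i\<bar> = 1" for i
    using x'_out[of i] that A by auto
  have xp': "x' p = x p + \<delta>" by (simp add: x'_def up)
  have xp_le: "\<bar>x p\<bar> \<le> 1" "\<bar>x p + \<delta>\<bar> \<le> 1" using x x'_le AI p xp' by (metis subsetD)+
  have S': "S t x' = S t x + \<delta> * \<eta> t" for t
    unfolding S_def x'_def u_sum[symmetric]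
    by (simp add: algebra_simps sum.distrib sum_distrib_left)
  define P' where "P' = (\<lambda>t. exp (S t x' + 4 * ((1 - (x' p)\<^sup>2) * n A t + (x' p)\<^sup>2 * n Q t)))"
  have "(\<Sum>t\<in>T. P' t) \<le> (\<Sum>t\<in>T. P t * (1 + \<delta> * (\<eta> t - 8 * W t * x p)))"
  proof (rule sum_mono)
    fix t assume t: "t \<in> T"
    have "P' t = P t * exp (\<delta> * \<eta> t - 4 * W t * (2 * x p * \<delta> + \<delta>\<^sup>2))"
      unfolding P'_def P_def exp_add[symmetric]
      by (rule arg_cong[of _ _ exp])
        (simp add: S' xp' W_def power2_eq_square algebra_simps)
    also have "\<dots> \<le> P t * (1 + \<delta> * (\<eta> t - 8 * W t * x p))"
      using xp_le W W_le[OF t]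
      by (intro mult_left_mono exp_step_bound) (auto simp: P_def)
    finally show "P' t \<le> P t * (1 + \<delta> * (\<eta> t - 8 * W t * x p))" .
  qed
  also have "\<dots> = (\<Sum>t\<in>T. P t) + \<delta> * K"
    by (simp add: K_def sum_distrib_left algebra_simps sum.distrib sum_subtractf)
  also have "\<dots> \<le> (\<Sum>t\<in>T. P t)" using \<delta>(1) by simp
  finally have P'P: "(\<Sum>t\<in>T. P' t) \<le> (\<Sum>t\<in>T. P t)" .
  have cardA': "card A' < card A" using A'_sub finA by (intro psubset_card_mono) auto
  have sq: "(x' i)\<^sup>2 \<le> 1" if "i \<in> I" for i
    using x'_le that by (simp add: abs_square_le_1)
  have "\<exists>y. (\<forall>i\<in>I. \<bar>y i\<bar> = 1) \<and> (\<forall>i\<in>I. \<bar>x' i\<bar> = 1 \<longrightarrow> y i = x' i) \<and>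
     (\<Sum>t\<in>T. exp (S t y)) \<le> (\<Sum>t\<in>T. P' t)"
  proof (cases "A' = {}")
    case True
    then have "\<forall>i\<in>I. \<bar>x' i\<bar> = 1" using x'_le by (force simp: A'_def)
    moreover have "exp (S t x') \<le> P' t" for t
      using n_nonneg[of A t] n_nonneg[of Q t] sq[of p] AI p by (auto simp: P'_def)
    ultimately show ?thesis by (intro exI[of _ x']) (auto intro: sum_mono)
  next
    case False
    \<comment> \<open>The pivot is kept while it is unfixed; otherwise any unfixed index takes
      over.\<close>
    obtain p' where p': "p' \<in> A'" "p \<in> A' \<Longrightarrow> p' = p" using False by blast
    obtain y where y: "\<forall>i\<in>I. \<bar>y i\<bar> = 1" "\<forall>i\<in>I. \<bar>x' i\<bar> = 1 \<longrightarrow> y i = x' i"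
      "(\<Sum>t\<in>T. exp (S t y))
        \<le> (\<Sum>t\<in>T. exp (S t x' + 4 * ((1 - (x' p')\<^sup>2) * n A' t + (x' p')\<^sup>2 * n (A' - {p'}) t)))"
      using less.hyps[OF cardA' x'_le A'_def p'(1)] by blast
    \<comment> \<open>A surviving pivot needs only monotonicity of \<open>n\<close>. Once the pivot
      is fixed, \<open>x' p\<close> has square 1, so the old bracket is \<open>n Q t\<close>, and
      \<open>A' \<subseteq> Q\<close> bounds both terms of the new one: the change of pivot is
      free.\<close>
    have "(1 - (x' p')\<^sup>2) * n A' t + (x' p')\<^sup>2 * n (A' - {p'}) t
      \<le> (1 - (x' p)\<^sup>2) * n A t + (x' p)\<^sup>2 * n Q t" for t
    proof (cases "p \<in> A'")
      case True
      then have "n A' t \<le> n A t" "n (A' - {p'}) t \<le> n Q t"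
        using p' A'_sub by (auto intro!: n_mono simp: Q_def)
      moreover have "(x' p)\<^sup>2 \<le> 1" using sq AI p by auto
      ultimately show ?thesis using p'(2)[OF True] by (auto intro!: add_mono mult_left_mono)
    next
      case F: False
      then have "\<bar>x' p\<bar> = 1" using x'_le AI p by (force simp: A'_def)
      then have one: "(x' p)\<^sup>2 = 1" by (metis power2_abs one_power2)
      have le: "n A' t \<le> n Q t" "n (A' - {p'}) t \<le> n Q t"
        using F A'_sub by (auto intro!: n_mono simp: Q_def)
      have "(x' p')\<^sup>2 \<le> 1" using sq p' A'_sub AI by auto
      then have "(1 - (x' p')\<^sup>2) * n A' t + (x' p')\<^sup>2 * n (A' - {p'}) t
          \<le> (1 - (x' p')\<^sup>2) * n Q t + (x' p')\<^sup>2 * n Q t"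
        using le by (intro add_mono mult_left_mono) auto
      then show ?thesis by (simp add: one algebra_simps)
    qed
    then have "(\<Sum>t\<in>T. exp (S t x' + 4 * ((1 - (x' p')\<^sup>2) * n A' t + (x' p')\<^sup>2 * n (A' - {p'}) t)))
      \<le> (\<Sum>t\<in>T. P' t)"
      unfolding P'_def by (intro sum_mono iffD2[OF exp_le_cancel_iff] add_left_mono mult_left_mono) auto
    then show ?thesis using y by (intro exI[of _ y]) auto
  qed
  then obtain y where y: "\<forall>i\<in>I. \<bar>y i\<bar> = 1" "\<forall>i\<in>I. \<bar>x' i\<bar> = 1 \<longrightarrow> y i = x' i"
      "(\<Sum>t\<in>T. exp (S t y)) \<le> (\<Sum>t\<in>T. P' t)" by blast
  show ?case
    using y fixed P'P unfolding P_def Q_def by (intro exI[of _ y]) auto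
qed

text \<open>With \<open>c\<close> centring the sums at 0, each initial term is at most
  \<open>exp (4 * (1/400))\<close>. A single final term is at most the whole sum, and taking
  logarithms gives the bound.\<close>

lemma signed_rounding:
  fixes v :: "'i \<Rightarrow> 'b \<Rightarrow> real" and w :: "'t \<Rightarrow> 'b \<Rightarrow> real" and x :: "'i \<Rightarrow> real"
  assumes fin: "finite I" "finite B" "finite T"
    and v: "\<And>i. i \<in> I \<Longrightarrow> dotp B (v i) (v i) \<le> 1"
    and w: "\<And>t. t \<in> T \<Longrightarrow> dotp B (w t) (w t) \<le> 1/400"
    and x: "\<And>i. i \<in> I \<Longrightarrow> \<bar>x i\<bar> \<le> 1"
  shows "\<exists>y. (\<forall>i\<in>I. \<bar>y i\<bar> = 1) \<and> (\<forall>i\<in>I. \<bar>x i\<bar> = 1 \<longrightarrow> y i = x i) \<and>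
     (\<forall>t\<in>T. (\<Sum>i\<in>I. (y i - x i) * dotp B (w t) (v i)) \<le> ln (real (card T)) + 1/100)"
proof -
  define A where "A = {i\<in>I. \<bar>x i\<bar> < 1}"
  define c where "c = (\<lambda>t. - (\<Sum>i\<in>I. x i * dotp B (w t) (v i)))"
  have "\<exists>y. (\<forall>i\<in>I. \<bar>y i\<bar> = 1) \<and> (\<forall>i\<in>I. \<bar>x i\<bar> = 1 \<longrightarrow> y i = x i) \<and>
     (\<Sum>t\<in>T. exp (c t + (\<Sum>i\<in>I. y i * dotp B (w t) (v i)))) \<le> (\<Sum>t\<in>T. exp (1/100))"
  proof (cases "A = {}")
    \<comment> \<open>Without an unfixed coefficient there is no pivot, and \<open>x\<close> itself
      is the rounding.\<close>
    case True
    then have "\<forall>i\<in>I. \<bar>x i\<bar> = 1" using x by (force simp: A_def)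
    moreover have "1 \<le> exp (1/100 :: real)" by simp
    ultimately show ?thesis
      by (intro exI[of _ x]) (auto simp: c_def simp del: sum_constant intro!: sum_mono)
  next
    case False
    then obtain p where p: "p \<in> A" by blast
    let ?n = "\<lambda>A t. dotp B (w t) (w t) - resid B v A (w t)"
    obtain y where y: "\<forall>i\<in>I. \<bar>y i\<bar> = 1" "\<forall>i\<in>I. \<bar>x i\<bar> = 1 \<longrightarrow> y i = x i"
      "(\<Sum>t\<in>T. exp (c t + (\<Sum>i\<in>I. y i * dotp B (w t) (v i))))
       \<le> (\<Sum>t\<in>T. exp (c t + (\<Sum>i\<in>I. x i * dotp B (w t) (v i))
            + 4 * ((1 - (x p)\<^sup>2) * ?n A t + (x p)\<^sup>2 * ?n (A - {p}) t)))"
      using gram_schmidt_walk[where v = v and w = w and c = c, OF fin v w _ A_def p] x by blast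
    have "(x p)\<^sup>2 \<le> 1" using x p by (simp add: abs_square_le_1 A_def)
    have "4 * ((1 - (x p)\<^sup>2) * ?n A t + (x p)\<^sup>2 * ?n (A - {p}) t) \<le> 1/100" if "t \<in> T" for t
    proof -
      have n: "?n A t \<le> 1/400" "?n (A - {p}) t \<le> 1/400"
        using w[OF that] resid_nonneg[of B v _ "w t"] by (smt (verit))+
      have "(1 - (x p)\<^sup>2) * ?n A t + (x p)\<^sup>2 * ?n (A - {p}) t
          \<le> (1 - (x p)\<^sup>2) * (1/400) + (x p)\<^sup>2 * (1/400)"
        using n \<open>(x p)\<^sup>2 \<le> 1\<close> by (intro add_mono mult_left_mono) auto
      also have "\<dots> = 1/400" by (simp add: field_simps)
      finally show ?thesis using mult_left_mono[of _ "1/400" "4 :: real"] by fastforce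
    qed
    then have "(\<Sum>t\<in>T. exp (c t + (\<Sum>i\<in>I. x i * dotp B (w t) (v i))
            + 4 * ((1 - (x p)\<^sup>2) * ?n A t + (x p)\<^sup>2 * ?n (A - {p}) t))) \<le> (\<Sum>t\<in>T. exp (1/100))"
      by (intro sum_mono) (simp add: c_def)
    then show ?thesis using y by (intro exI[of _ y]) auto
  qed
  then obtain y where y: "\<forall>i\<in>I. \<bar>y i\<bar> = 1" "\<forall>i\<in>I. \<bar>x i\<bar> = 1 \<longrightarrow> y i = x i"
    "(\<Sum>t\<in>T. exp (c t + (\<Sum>i\<in>I. y i * dotp B (w t) (v i)))) \<le> real (card T) * exp (1/100)"
    by auto
  have "(\<Sum>i\<in>I. (y i - x i) * dotp B (w t) (v i)) \<le> ln (real (card T)) + 1/100"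
    if t: "t \<in> T" for t
  proof -
    have T0: "0 < real (card T)" using t fin by (auto simp: card_gt_0_iff)
    have "exp (\<Sum>i\<in>I. (y i - x i) * dotp B (w t) (v i))
        = exp (c t + (\<Sum>i\<in>I. y i * dotp B (w t) (v i)))"
      by (simp add: c_def algebra_simps sum_subtractf)
    also have "\<dots> \<le> (\<Sum>t\<in>T. exp (c t + (\<Sum>i\<in>I. y i * dotp B (w t) (v i))))"
      using fin t by (intro member_le_sum) auto
    also have "\<dots> \<le> real (card T) * exp (1/100)" by (rule y(3))
    also have "\<dots> = exp (ln (real (card T)) + 1/100)" using T0 by (simp add: exp_add)
    finally show ?thesis by simp
  qed
  then show ?thesis using y by blast
qed

subsection \<open>Rounding on a grid\<close>

text \<open>Rescaling of \<open>signed_rounding\<close>. The vectors contribute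
  \<open>1 / (20 * R)\<close> to the inner products, and passing from signs to 0/1 values a factor
  2, hence \<open>10 * R\<close>. Including both signs of each \<open>w t\<close> doubles the test
  family and yields absolute values.\<close>

lemma zero_one_rounding:
  fixes v :: "'i \<Rightarrow> 'b \<Rightarrow> real" and w :: "'t \<Rightarrow> 'b \<Rightarrow> real" and x :: "'i \<Rightarrow> real"
  assumes fin: "finite I" "finite B" "finite T" and R: "R > 0"
    and v: "\<And>i. i \<in> I \<Longrightarrow> dotp B (v i) (v i) \<le> R"
    and w: "\<And>t. t \<in> T \<Longrightarrow> dotp B (w t) (w t) \<le> R"
    and x: "\<And>i. i \<in> I \<Longrightarrow> 0 \<le> x i \<and> x i \<le> 1"
  shows "\<exists>y. (\<forall>i\<in>I. y i = 0 \<or> y i = 1) \<and> (\<forall>i\<in>I. x i = 0 \<longrightarrow> y i = 0) \<and>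
     (\<forall>t\<in>T. \<bar>\<Sum>i\<in>I. (y i - x i) * dotp B (w t) (v i)\<bar> \<le> 10 * R * (ln (2 * real (card T)) + 1/100))"
proof -
  define v' where "v' = (\<lambda>i b. (1 / sqrt R) * v i b)"
  define w' where "w' = (\<lambda>(t, s) b. (s / (20 * sqrt R)) * w t b)"
  define T' where "T' = T \<times> {1, - 1 :: real}"
  have cardT': "card T' = 2 * card T" by (simp add: T'_def card_cartesian_product)
  have "dotp B (v' i) (v' i) \<le> 1" if "i \<in> I" for i
    using v[OF that] R unfolding v'_def dotp_scale_left dotp_scale_right by (simp add: field_simps)
  moreover have "dotp B (w' ts) (w' ts) \<le> 1/400" if tsT: "ts \<in> T'" for ts
  proof -
    obtain t s where ts: "ts = (t, s)" "t \<in> T" "s * s = 1"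
      using tsT by (auto simp: T'_def)
    have "dotp B (w' ts) (w' ts) = (s * s) * dotp B (w t) (w t) / (400 * (sqrt R * sqrt R))"
      unfolding ts(1) w'_def prod.case dotp_scale_left dotp_scale_right by simp
    also have "\<dots> \<le> 1/400" using w[OF ts(2)] R ts by (simp add: field_simps)
    finally show ?thesis .
  qed
  moreover have "\<bar>2 * x i - 1\<bar> \<le> 1" if "i \<in> I" for i using x[OF that] by auto
  moreover have "finite T'" using fin by (simp add: T'_def)
  ultimately obtain y where y: "\<forall>i\<in>I. \<bar>y i\<bar> = 1" "\<forall>i\<in>I. \<bar>2 * x i - 1\<bar> = 1 \<longrightarrow> y i = 2 * x i - 1"
     "\<forall>ts\<in>T'. (\<Sum>i\<in>I. (y i - (2 * x i - 1)) * dotp B (w' ts) (v' i)) \<le> ln (real (card T')) + 1/100"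
    using signed_rounding[OF fin(1,2), of T' v' w' "\<lambda>i. 2 * x i - 1"] by blast
  define y' where "y' = (\<lambda>i. (y i + 1) / 2)"
  have "y' i = 0 \<or> y' i = 1" if "i \<in> I" for i
    using y(1) that by (auto simp: y'_def abs_if split: if_splits)
  moreover have "y' i = 0" if "i \<in> I" "x i = 0" for i
    using y(2) that by (auto simp: y'_def)
  moreover have "\<bar>\<Sum>i\<in>I. (y' i - x i) * dotp B (w t) (v i)\<bar> \<le> 10 * R * (ln (2 * real (card T)) + 1/100)"
    if t: "t \<in> T" for t
  proof -
    define D where "D = (\<Sum>i\<in>I. (y' i - x i) * dotp B (w t) (v i))"
    have "s * D \<le> 10 * R * (ln (2 * real (card T)) + 1/100)" if s: "s \<in> {1, -1}" for s
    proof -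
      have "(\<Sum>i\<in>I. (y i - (2 * x i - 1)) * dotp B (w' (t, s)) (v' i))
          = (\<Sum>i\<in>I. s / (10 * R) * ((y' i - x i) * dotp B (w t) (v i)))"
      proof (rule sum.cong)
        fix i
        have *: "dotp B (w' (t, s)) (v' i) = s / (20 * R) * dotp B (w t) (v i)"
          unfolding w'_def v'_def prod.case dotp_scale_left dotp_scale_right using R by simp
        show "(y i - (2 * x i - 1)) * dotp B (w' (t, s)) (v' i)
          = s / (10 * R) * ((y' i - x i) * dotp B (w t) (v i))"
          unfolding * y'_def using R by (simp add: field_simps)
      qed simp
      also have "\<dots> = s / (10 * R) * D" by (simp add: D_def sum_distrib_left)
      finally have "s / (10 * R) * D \<le> ln (2 * real (card T)) + 1/100"
        using y(3) t s cardT' by (force simp: T'_def)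
      then show ?thesis using R by (simp add: field_simps)
    qed
    from this[of 1] this[of "-1"] show ?thesis by (simp add: D_def abs_le_iff)
  qed
  ultimately show ?thesis by (intro exI[of _ y']) auto
qed

text \<open>Each binary digit 1 of \<open>m\<close>, at position \<open>l\<close>, contributes the
  dyadic interval of length \<open>2 ^ l\<close> and index \<open>m div 2 ^ l - 1\<close>; these
  intervals partition the numbers below \<open>m\<close>. Induction halves \<open>m\<close> and
  \<open>i\<close>, the level 0 term catching only \<open>i = m - 1\<close> for odd
  \<open>m\<close>.\<close>

lemma dyadic_prefix_decomposition:
  fixes m i K :: nat
  assumes "m < 2 ^ K"
  shows "(\<Sum>l<K. of_bool (odd (m div 2 ^ l) \<and> i div 2 ^ l + 1 = m div 2 ^ l)) = (of_bool (i < m) :: real)"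
  using assms
proof (induction K arbitrary: m i)
  case 0
  then show ?case by simp
next
  case (Suc K)
  have "m div 2 < 2 ^ K" using Suc.prems by auto
  have "(\<Sum>l<Suc K. of_bool (odd (m div 2 ^ l) \<and> i div 2 ^ l + 1 = m div 2 ^ l))
     = of_bool (odd m \<and> i + 1 = m)
       + (\<Sum>l<K. of_bool (odd (m div 2 div 2 ^ l) \<and> i div 2 div 2 ^ l + 1 = m div 2 div 2 ^ l) :: real)"
    by (subst sum.lessThan_Suc_shift) (simp add: div_mult2_eq)
  also have "\<dots> = of_bool (odd m \<and> i + 1 = m) + of_bool (i div 2 < m div 2)"
    by (simp only: Suc.IH[OF \<open>m div 2 < 2 ^ K\<close>])
  also have "\<dots> = of_bool (i < m)"
  proof (cases "odd m \<and> i + 1 = m")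
    case True
    then have "i div 2 = m div 2" by presburger
    then show ?thesis using True by auto
  next
    case False
    then have "i div 2 < m div 2 \<longleftrightarrow> i < m" by presburger
    then show ?thesis using False by auto
  qed
  finally show ?case .
qed

text \<open>Coordinates are dyadic boxes, given by a level and an index per axis. \<open>v i\<close>
  marks the boxes containing cell \<open>i\<close>, \<open>w m\<close> those decomposing the prefix
  box below \<open>m\<close>. Each marks at most one box per level vector, so squared norms are at
  most \<open>K ^ CARD('d)\<close>.\<close>

lemma grid_rounding:
  fixes x :: "('d::finite \<Rightarrow> nat) \<Rightarrow> real" and K :: nat
  defines "I \<equiv> (UNIV :: 'd set) \<rightarrow>\<^sub>E {..<2 ^ K}"
  assumes K: "K > 0" and x: "\<And>i. i \<in> I \<Longrightarrow> 0 \<le> x i \<and> x i \<le> 1"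
  shows "\<exists>y. (\<forall>i\<in>I. y i = 0 \<or> y i = 1) \<and> (\<forall>i\<in>I. x i = 0 \<longrightarrow> y i = 0) \<and>
     (\<forall>m\<in>I. \<bar>\<Sum>i\<in>{i\<in>I. \<forall>s. i s < m s}. y i - x i\<bar>
        \<le> 10 * real K ^ CARD('d) * (ln (2 * real (card I)) + 1/100))"
proof -
  define Lv where "Lv = (UNIV :: 'd set) \<rightarrow>\<^sub>E {..<K}"
  define v where "v = (\<lambda>(i :: 'd \<Rightarrow> nat) (l, j). of_bool (j = (\<lambda>s. i s div 2 ^ l s)) :: real)"
  define w where "w = (\<lambda>(m :: 'd \<Rightarrow> nat) (l, j).
      of_bool (\<forall>s. odd (m s div 2 ^ l s) \<and> j s + 1 = m s div 2 ^ l s) :: real)"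
  have finI: "finite I" unfolding I_def by (intro finite_PiE) auto
  have finL: "finite Lv" unfolding Lv_def by (intro finite_PiE) auto
  have cardL: "card Lv = K ^ CARD('d)" unfolding Lv_def by (simp add: card_PiE)
  have dotp_prod: "dotp (Lv \<times> I) f g = (\<Sum>l\<in>Lv. \<Sum>j\<in>I. f (l, j) * g (l, j))" for f g
    by (simp add: dotp_def sum.cartesian_product)
  have single: "(\<Sum>j\<in>I. of_bool (j = k) * f j) \<le> (1 :: real)" if "\<And>j. f j \<le> 1" for k and f :: "_ \<Rightarrow> real"
    using that finI by (cases "k \<in> I") auto
  have pick: "(\<Sum>j\<in>I. of_bool (P j) * of_bool (j = k)) = (of_bool (P k) :: real)" if "k \<in> I" for P k
  proof -
    have "(\<Sum>j\<in>I. of_bool (P j) * of_bool (j = k)) = (\<Sum>j\<in>I. if j = k then of_bool (P k) else (0 :: real))"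
      by (intro sum.cong) auto
    then show ?thesis using that finI by simp
  qed
  have v_norm: "dotp (Lv \<times> I) (v i) (v i) \<le> real K ^ CARD('d)" for i
  proof -
    have "dotp (Lv \<times> I) (v i) (v i) \<le> (\<Sum>l\<in>Lv. 1)"
      unfolding dotp_prod v_def prod.case by (intro sum_mono single) auto
    then show ?thesis by (simp add: cardL)
  qed
  have w_norm: "dotp (Lv \<times> I) (w m) (w m) \<le> real K ^ CARD('d)" for m
  proof -
    \<comment> \<open>At a given level vector only one index can be marked; oddness makes the
      truncated subtraction exact.\<close>
    have "dotp (Lv \<times> I) (w m) (w m) \<le> (\<Sum>l\<in>Lv. \<Sum>j\<in>I. of_bool (j = (\<lambda>s. m s div 2 ^ l s - 1)) * 1)"
      unfolding dotp_prod w_def prod.case by (intro sum_mono) (auto simp: fun_eq_iff, metis diff_Suc_1)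
    also have "\<dots> \<le> (\<Sum>l\<in>Lv. 1)" by (intro sum_mono single) auto
    finally show ?thesis by (simp add: cardL)
  qed
  have dotp_wv: "dotp (Lv \<times> I) (w m) (v i) = of_bool (\<forall>s. i s < m s)" if m: "m \<in> I" and i: "i \<in> I" for m i
  proof -
    have iI: "(\<lambda>s. i s div 2 ^ l s) \<in> I" for l
      using i by (auto simp: I_def PiE_iff intro: le_less_trans[OF div_le_dividend])
    have "dotp (Lv \<times> I) (w m) (v i)
        = (\<Sum>l\<in>Lv. of_bool (\<forall>s. odd (m s div 2 ^ l s) \<and> i s div 2 ^ l s + 1 = m s div 2 ^ l s))"
      unfolding dotp_prod w_def v_def prod.case
      by (intro sum.cong refl pick iI)
    \<comment> \<open>As a product over the axes, the sum over level vectors factors into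
      one-dimensional decompositions.\<close>
    also have "\<dots> = (\<Sum>l\<in>Lv. \<Prod>s\<in>UNIV. of_bool (odd (m s div 2 ^ l s) \<and> i s div 2 ^ l s + 1 = m s div 2 ^ l s))"
      by (intro sum.cong refl) auto
    also have "\<dots> = (\<Prod>s\<in>UNIV. \<Sum>l<K. of_bool (odd (m s div 2 ^ l) \<and> i s div 2 ^ l + 1 = m s div 2 ^ l))"
      unfolding Lv_def by (subst prod_sum_PiE) auto
    also have "\<dots> = (\<Prod>s\<in>UNIV. of_bool (i s < m s))"
      using m by (intro prod.cong refl dyadic_prefix_decomposition) (auto simp: I_def PiE_iff)
    also have "\<dots> = of_bool (\<forall>s. i s < m s)" by auto
    finally show ?thesis .
  qed
  obtain y where y: "\<forall>i\<in>I. y i = 0 \<or> y i = 1" "\<forall>i\<in>I. x i = 0 \<longrightarrow> y i = 0"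
     "\<forall>m\<in>I. \<bar>\<Sum>i\<in>I. (y i - x i) * dotp (Lv \<times> I) (w m) (v i)\<bar>
        \<le> 10 * real K ^ CARD('d) * (ln (2 * real (card I)) + 1/100)"
    using zero_one_rounding[OF finI _ finI, of "Lv \<times> I" "real K ^ CARD('d)" v w x] K x v_norm w_norm finI finL
    by auto
  have "(\<Sum>i\<in>I. (y i - x i) * dotp (Lv \<times> I) (w m) (v i)) = (\<Sum>i\<in>{i\<in>I. \<forall>s. i s < m s}. y i - x i)"
    if "m \<in> I" for m
    using finI dotp_wv[OF that] by (intro sum.mono_neutral_cong_right) auto
  then show ?thesis using y by (intro exI[of _ y]) auto
qed

subsection \<open>Quantile levels\<close>

lemma measurable_mono_nat:
  fixes g :: "real \<Rightarrow> nat"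
  assumes "mono g"
  shows "g \<in> borel \<rightarrow>\<^sub>M count_space UNIV"
proof -
  have "mono (\<lambda>t. real (g t))" using assms by (auto simp: mono_def)
  then have m: "(\<lambda>t. real (g t)) \<in> borel_measurable borel" by (rule borel_measurable_mono)
  have "g -` {k} \<inter> space borel \<in> sets borel" for k
  proof -
    have "(\<lambda>t. real (g t)) -` {real k} \<inter> space borel \<in> sets borel"
      using m by (rule measurable_sets) auto
    moreover have "(\<lambda>t. real (g t)) -` {real k} \<inter> space borel = g -` {k} \<inter> space borel" by auto
    ultimately show ?thesis by simp
  qed
  then show ?thesis by (auto simp: measurable_count_space_eq2_countable)
qed

text \<open>On a level both the rounded distribution function and its rounded left limit are
  constant, so each varies by at most 1/N; chaining the two bounds a segment's mass by 2/N. A point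
  \<open>a\<close> at the top of its level is exempt, because the half-line up to \<open>a\<close>
  is then a union of levels; this accommodates heavy atoms.\<close>

lemma quantile_levels:
  fixes \<nu> :: "real measure" and N :: nat
  assumes "prob_space \<nu>" and sets: "sets \<nu> = sets borel" and N: "N \<ge> 1"
  shows "\<exists>g :: real \<Rightarrow> nat. mono g \<and> (\<forall>t. g t \<le> 2 * N) \<and>
     (\<forall>a. (\<forall>y. g y = g a \<longrightarrow> y \<le> a) \<or> measure \<nu> {y. g y = g a} \<le> 2 / real N)"
proof -
  interpret prob_space \<nu> by fact
  define F where "F t = prob {..t}" for t
  define F' where "F' t = prob {..<t}" for t
  have [measurable]: "A \<in> borel \<Longrightarrow> A \<in> events" for A using sets by auto
  have FF': "F s \<le> F' t" if "s < t" for s t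
    unfolding F_def F'_def using that by (intro finite_measure_mono) auto
  have F'F: "F' t \<le> F t" for t
    unfolding F_def F'_def by (intro finite_measure_mono) auto
  have F_mono: "F s \<le> F t" "F' s \<le> F' t" if "s \<le> t" for s t
    unfolding F_def F'_def using that by (auto intro!: finite_measure_mono)
  have F_bounds: "0 \<le> F t" "F t \<le> 1" "0 \<le> F' t" "F' t \<le> 1" for t
    by (auto simp: F_def F'_def)
  define h where "h t = \<lfloor>N * F t\<rfloor>" for t
  define h' where "h' t = \<lceil>N * F' t\<rceil>" for t
  \<comment> \<open>The ceiling of the left limit puts an atom of mass at least \<open>1 / N\<close> at the end of its level.\<close>
  define g where "g t = nat (h t + h' t)" for t
  have h_mono: "h s \<le> h t" "h' s \<le> h' t" if "s \<le> t" for s t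
    using F_mono[OF that] by (auto simp: h_def h'_def intro!: floor_mono ceiling_mono mult_left_mono)
  have h_bounds: "0 \<le> h t" "h t \<le> N" "0 \<le> h' t" "h' t \<le> N" for t
  proof -
    have "real N * F t \<le> real N" "real N * F' t \<le> real N"
      using F_bounds[of t] by (auto intro: mult_left_le)
    moreover have "0 \<le> real N * F t" "0 \<le> real N * F' t" using F_bounds[of t] by auto
    ultimately show "0 \<le> h t" "h t \<le> N" "0 \<le> h' t" "h' t \<le> N"
      unfolding h_def h'_def
      by (auto simp: floor_le_iff ceiling_le_iff)
  qed
  have g_mono: "mono g"
    using h_mono by (auto simp: mono_def g_def intro!: nat_mono add_mono)
  have "g t \<le> 2 * N" for t using h_bounds[of t] by (auto simp: g_def)
  moreover have bound: "measure \<nu> {y. g y = g a} \<le> 2 / real N" if y: "g y = g a" "a < y" for a y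
  proof -
    define C where "C = {t. g t = g a}"
    have seg: "prob {z..z'} \<le> 2 / real N" if z: "z \<in> C" "z' \<in> C" "z < z'" for z z'
    proof -
      have "h z + h' z = h z' + h' z'"
        using z h_bounds[of z] h_bounds[of z'] by (auto simp: C_def g_def nat_eq_iff)
      then have eq: "h z = h z'" "h' z = h' z'"
        using h_mono[of z z'] z by auto
      have "N * F z' - N * F z \<le> 1" "N * F' z' - N * F' z \<le> 1"
        using eq unfolding h_def h'_def by linarith+
      moreover have "N * F z \<le> N * F' z'" using FF'[OF z(3)] by (intro mult_left_mono) auto
      ultimately have *: "N * (F z' - F' z) \<le> 2" by (simp add: algebra_simps)
      have "{..z'} = {..<z} \<union> {z..z'}" using z by auto
      then have "F z' = F' z + prob {z..z'}"
        unfolding F_def F'_def by (simp, subst finite_measure_Union) auto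
      then have "N * prob {z..z'} \<le> 2" using * by simp
      then show ?thesis using N by (simp add: field_simps)
    qed
    have "g -` {g a} \<inter> space borel \<in> sets borel"
      using measurable_mono_nat[OF g_mono] by (rule measurable_sets) auto
    moreover have "g -` {g a} \<inter> space borel = C" by (auto simp: C_def)
    ultimately have C: "C \<in> sets borel" by simp
    \<comment> \<open>The level need not contain its endpoints; inner regularity reduces it to
      compact subsets, which lie between two of its points.\<close>
    have "emeasure \<nu> C = (SUP K\<in>{K. K \<subseteq> C \<and> compact K}. emeasure \<nu> K)"
      using C sets by (intro inner_regular) auto
    also have "\<dots> \<le> ennreal (2 / real N)"
    proof (rule SUP_least)
      fix K assume "K \<in> {K. K \<subseteq> C \<and> compact K}"
      then have K: "K \<subseteq> C" "compact K" by auto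
      have "\<exists>z\<in>C. \<exists>z'\<in>C. z < z' \<and> K \<subseteq> {z..z'}"
      proof (cases "K = {}")
        case True
        then show ?thesis using y by (auto simp: C_def)
      next
        case False
        obtain l where l: "l \<in> K" "\<forall>k\<in>K. l \<le> k" using compact_attains_inf[OF K(2) False] by blast
        obtain u where u: "u \<in> K" "\<forall>k\<in>K. k \<le> u" using compact_attains_sup[OF K(2) False] by blast
        \<comment> \<open>Including \<open>a\<close> and \<open>y\<close> keeps the endpoints
          distinct even if \<open>K\<close> is a single point.\<close>
        have "min l a \<in> C" "max u y \<in> C" using l u K y by (auto simp: min_def max_def C_def)
        moreover have "min l a < max u y" "K \<subseteq> {min l a..max u y}" using l u y by fastforce+
        ultimately show ?thesis by blast
      qed
      then obtain z z' where z: "z \<in> C" "z' \<in> C" "z < z'" "K \<subseteq> {z..z'}" by blast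
      have "emeasure \<nu> K \<le> emeasure \<nu> {z..z'}" using z by (intro emeasure_mono) auto
      also have "\<dots> = ennreal (prob {z..z'})" by (rule emeasure_eq_measure)
      also have "\<dots> \<le> ennreal (2 / real N)" using seg z by (intro ennreal_leI) auto
      finally show "emeasure \<nu> K \<le> ennreal (2 / real N)" .
    qed
    finally show ?thesis by (simp add: C_def emeasure_eq_measure)
  qed
  moreover have "(\<forall>y. g y = g a \<longrightarrow> y \<le> a) \<or> measure \<nu> {y. g y = g a} \<le> 2 / real N" for a
  proof (cases "\<forall>y. g y = g a \<longrightarrow> y \<le> a")
    case False
    then obtain y where "g y = g a" "a < y" by (auto simp: not_le)
    then show ?thesis using bound by blast
  qed blast
  ultimately show ?thesis using g_mono by blast
qed

subsection \<open>Point sets of small discrepancy\<close>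

text \<open>The rounded cell counts need not add up to \<open>N\<close>. Truncating or padding the
  list repairs its length at the cost of the length error.\<close>

lemma filter_length_adjust:
  fixes xs :: "'a list"
  assumes "zs = take N (xs @ replicate N z)"
  shows "\<bar>real (length (filter P zs)) - real (length (filter P xs))\<bar> \<le> \<bar>real N - real (length xs)\<bar>"
proof (cases "N \<le> length xs")
  case True
  have "length (filter P xs) = length (filter P (take N xs)) + length (filter P (drop N xs))"
    by (metis append_take_drop_id filter_append length_append)
  moreover have "length (filter P (drop N xs)) \<le> length xs - N"
    using length_filter_le[of P "drop N xs"] by simp
  ultimately show ?thesis using True assms by auto
next
  case False
  have "length (filter P (replicate (N - length xs) z)) \<le> N - length xs"
    using length_filter_le[of P "replicate (N - length xs) z"] by simp
  then show ?thesis using False assms by auto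
qed

lemma sum_indicator_nth:
  "(\<Sum>n=1..length zs. indicator A (zs ! (n - 1))) = real (length (filter (\<lambda>x. x \<in> A) zs))"
proof -
  have "(\<Sum>n=1..length zs. indicator A (zs ! (n - 1)) :: real) = (\<Sum>n<length zs. indicator A (zs ! n))"
    by (rule sum.reindex_bij_witness[of _ Suc "\<lambda>n. n - 1"]) auto
  also have "\<dots> = (\<Sum>x\<leftarrow>zs. indicator A x)"
    by (simp add: sum_list_sum_nth atLeast0LessThan)
  also have "\<dots> = real (length (filter (\<lambda>x. x \<in> A) zs))"
    by (induction zs) (auto simp: indicator_def)
  finally show ?thesis .
qed

text \<open>The left side is at most \<open>24 * d * L ^ (d + 1)\<close>. Since
  \<open>d \<le> 2 ^ (d - 1) \<le> L ^ (d - 1)\<close>, one factor \<open>sqrt d\<close> is at most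
  \<open>L powr ((d - 1) / 2)\<close>, and the exponents add up to
  \<open>(3 * d + 1) / 2\<close>.\<close>

lemma rounding_error_le_claimed_bound:
  fixes L :: real and K d :: nat
  assumes d: "d \<ge> 1" and L: "2 \<le> L" and K: "real K \<le> L"
  shows "2 * (10 * real K ^ d * (ln (2 * real ((2 ^ K) ^ d)) + 1/100)) + 2 * real d
     \<le> 63 * sqrt (real d) * L powr ((3 * real d + 1) / 2)"
proof -
  have dL: "2 \<le> real d * L" using mult_mono[of 1 "real d" 2 L] d L by simp
  have ln_eq: "ln (2 * real ((2 ^ K) ^ d)) = (real K * real d + 1) * ln 2"
  proof -
    have "2 * real ((2 ^ K) ^ d) = 2 ^ (K * d + 1)" by (simp add: power_mult)
    then show ?thesis by (simp only: ln_realpow) simp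
  qed
  also have "(real K * real d + 1) * ln 2 \<le> (real K * real d + 1) * (7/10)"
    using ln2_le_25_over_36 by (intro mult_left_mono) auto
  also have "\<dots> \<le> (3/2 * (real d * L)) * (7/10)"
    using mult_right_mono[OF K, of "real d"] dL by (intro mult_right_mono) (auto simp: mult.commute)
  finally have ln_le: "ln (2 * real ((2 ^ K) ^ d)) \<le> (3/2 * (real d * L)) * (7/10)" .
  \<comment> \<open>The product of 3/2 and 7/10 is 105/100, and \<open>2 \<le> d * L\<close> makes
    1/100 at most \<open>d * L / 200\<close>.\<close>
  then have "ln (2 * real ((2 ^ K) ^ d)) + 1/100 \<le> 106/100 * (real d * L)"
    using dL by linarith
  moreover have "10 * real K ^ d \<le> 10 * L ^ d" using K by (intro mult_left_mono power_mono) auto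
  moreover have "0 \<le> ln (2 * real ((2 ^ K) ^ d)) + 1/100"
    unfolding ln_eq by simp
  ultimately have "10 * real K ^ d * (ln (2 * real ((2 ^ K) ^ d)) + 1/100)
      \<le> 10 * L ^ d * (106/100 * (real d * L))"
    using L by (intro mult_mono) auto
  moreover have "1 \<le> L ^ (d + 1)" using L by (intro one_le_power) auto
  then have "real d * 1 \<le> real d * L ^ (d + 1)" by (intro mult_left_mono) auto
  ultimately have "2 * (10 * real K ^ d * (ln (2 * real ((2 ^ K) ^ d)) + 1/100)) + 2 * real d
      \<le> 24 * (real d * L ^ (d + 1))"
    by (simp add: algebra_simps)
  also have "24 * (real d * L ^ (d + 1)) \<le> 24 * ((sqrt (real d) * L powr ((real d - 1) / 2)) * L ^ (d + 1))"
  proof -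
    have "real d \<le> sqrt (real d) * L powr ((real d - 1) / 2)"
    proof -
      have "real d \<le> 2 ^ (d - 1)"
      proof -
        have "d - 1 < 2 ^ (d - 1)" by (rule less_exp)
        then have "d \<le> 2 ^ (d - 1)" using d by linarith
        then show ?thesis by (metis of_nat_le_iff of_nat_numeral of_nat_power)
      qed
      also have "\<dots> \<le> L ^ (d - 1)" using L by (intro power_mono) auto
      also have "\<dots> = (L powr ((real d - 1) / 2))\<^sup>2"
      proof -
        have "(L powr ((real d - 1) / 2))\<^sup>2 = L powr (real (d - 1))"
          unfolding power2_eq_square powr_add[symmetric] using d by (simp add: of_nat_diff)
        also have "\<dots> = L ^ (d - 1)" using L by (intro powr_realpow) auto
        finally show ?thesis by simp
      qed
      finally have "sqrt (real d) \<le> L powr ((real d - 1) / 2)"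
        by (intro real_le_lsqrt) auto
      then have "sqrt (real d) * sqrt (real d) \<le> sqrt (real d) * L powr ((real d - 1) / 2)"
        by (intro mult_left_mono) auto
      then show ?thesis by simp
    qed
    then show ?thesis
      using L by (intro mult_left_mono mult_right_mono) auto
  qed
  also have "\<dots> = 24 * (sqrt (real d) * L powr ((3 * real d + 1) / 2))"
  proof -
    have "L powr ((real d - 1) / 2) * L powr (real (d + 1)) = L powr ((3 * real d + 1) / 2)"
      unfolding powr_add[symmetric] by (rule arg_cong[of _ _ "(powr) L"]) (simp add: field_simps)
    moreover have "L powr (real (d + 1)) = L ^ (d + 1)" using L by (intro powr_realpow) auto
    ultimately show ?thesis by (simp add: mult.assoc)
  qed
  also have "\<dots> \<le> 63 * sqrt (real d) * L powr ((3 * real d + 1) / 2)"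
    by (simp add: mult.assoc)
  finally show ?thesis by simp
qed

section \<open>Constructing the points from rounded cell masses\<close>

lemma length_filter_mono:
  "(\<And>x. x \<in> set xs \<Longrightarrow> P x \<Longrightarrow> Q x) \<Longrightarrow> length (filter P xs) \<le> length (filter Q xs)"
  by (induction xs) auto

text \<open>Each cell receives copies of one representative, as many as its rounded mass. An
  anchored box lies between two unions of cells differing by at most one light level per axis.
  Corners go up to \<open>2 * N + 1\<close> and must be grid indices, hence the condition on
  \<open>K\<close>.\<close>

lemma balanced_points_exist:
  fixes \<mu> :: "(real ^ 'd) measure" and N K :: nat
  assumes "prob_space \<mu>"
    and sets: "sets \<mu> = sets (restrict_space borel unit_cube)"
    and N: "N \<ge> 1" and K: "2 * N + 2 \<le> 2 ^ K"
  defines "E \<equiv> 10 * real K ^ CARD('d) * (ln (2 * real ((2 ^ K) ^ CARD('d))) + 1/100)"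
  shows "\<exists>xs. set xs \<subseteq> unit_cube \<and> \<bar>real (length xs) - real N\<bar> \<le> E \<and>
     (\<forall>a\<in>unit_cube. \<bar>real (length (filter (\<lambda>x. x \<in> cbox 0 a) xs)) - N * measure \<mu> (cbox 0 a)\<bar>
        \<le> E + 2 * real CARD('d))"
proof -
  interpret prob_space \<mu> by fact
  have space: "space \<mu> = unit_cube"
    using sets_eq_imp_space_eq[OF sets] by (simp add: space_restrict_space)
  have coord[measurable]: "(\<lambda>x. x $ s) \<in> borel_measurable \<mu>" for s
  proof -
    have "(\<lambda>x :: real ^ 'd. x $ s) \<in> borel_measurable (restrict_space borel unit_cube)"
      by (intro measurable_restrict_space1) simp
    then show ?thesis using measurable_cong_sets[OF sets refl] by blast
  qed
  define \<nu> where "\<nu> s = distr \<mu> borel (\<lambda>x. x $ s)" for s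
  have "\<exists>g :: real \<Rightarrow> nat. mono g \<and> (\<forall>t. g t \<le> 2 * N) \<and>
     (\<forall>a. (\<forall>y. g y = g a \<longrightarrow> y \<le> a) \<or> measure (\<nu> s) {y. g y = g a} \<le> 2 / real N)" for s
    using N by (intro quantile_levels) (auto simp: \<nu>_def intro: prob_space_distr)
  then obtain g :: "'d \<Rightarrow> real \<Rightarrow> nat" where g_mono: "\<And>s. mono (g s)"
    and g_le: "\<And>s t. g s t \<le> 2 * N"
    and g_level: "\<And>s a. (\<forall>y. g s y = g s a \<longrightarrow> y \<le> a) \<or> measure (\<nu> s) {y. g s y = g s a} \<le> 2 / real N"
    by metis
  note [measurable] = measurable_mono_nat[OF g_mono]
  define I where "I = (UNIV :: 'd set) \<rightarrow>\<^sub>E {..<(2::nat) ^ K}"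
  have finI: "finite I" unfolding I_def by (intro finite_PiE) auto
  have cardI: "card I = (2 ^ K) ^ CARD('d)" unfolding I_def by (simp add: card_PiE)
  have K0: "K > 0" using K N by (cases K) auto
  define cell where "cell c = {x\<in>space \<mu>. \<forall>s. g s (x $ s) = c s}" for c
  define box where "box m = {x\<in>space \<mu>. \<forall>s. g s (x $ s) < m s}" for m
  have cell_meas[measurable]: "cell c \<in> events" for c unfolding cell_def by measurable
  have box_meas[measurable]: "box m \<in> events" for m unfolding box_def by measurable
  \<comment> \<open>Only fractional parts are rounded; the integer parts are added back in
    \<open>n\<close>.\<close>
  define X where "X c = frac (N * prob (cell c))" for c
  have "0 \<le> X c \<and> X c \<le> 1" for c
    using frac_lt_1[of "N * prob (cell c)"] by (simp add: X_def)
  then obtain y where y: "\<forall>i\<in>I. y i = 0 \<or> y i = 1" "\<forall>i\<in>I. X i = 0 \<longrightarrow> y i = 0"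
     "\<forall>m\<in>I. \<bar>\<Sum>i\<in>{i\<in>I. \<forall>s. i s < m s}. y i - X i\<bar> \<le> E"
    using grid_rounding[OF K0, where x = X] unfolding E_def cardI[symmetric] I_def by blast
  define n where "n c = nat \<lfloor>N * prob (cell c)\<rfloor> + (if y c = 1 then 1 else 0)" for c
  have n: "real (n c) - N * prob (cell c) = y c - X c" if "c \<in> I" for c
    using y(1) that by (auto simp: n_def X_def frac_def)
  define r where "r c = (SOME x. x \<in> cell c)" for c
  \<comment> \<open>An empty cell has fractional part 0, which the rounding preserves, so it
    receives no points and the arbitrary choice in \<open>r\<close> does no harm.\<close>
  have r: "r c \<in> cell c" if "c \<in> I" "n c > 0" for c
  proof -
    have "cell c \<noteq> {}"
    proof
      assume "cell c = {}"
      then have "prob (cell c) = 0" by simp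
      then show False using y(2) that by (auto simp: n_def X_def)
    qed
    then show ?thesis unfolding r_def by (simp add: some_in_eq)
  qed
  obtain cs where cs: "set cs = I" "distinct cs" using finite_distinct_list[OF finI] by blast
  define xs where "xs = concat (map (\<lambda>c. replicate (n c) (r c)) cs)"
  have xs_space: "x \<in> space \<mu>" if "x \<in> set xs" for x
    using that r cs by (auto simp: xs_def cell_def)
  have cnt: "length (filter P xs) = (\<Sum>c\<in>I. if P (r c) then n c else 0)" for P
  proof -
    have "length (filter P xs) = (\<Sum>c\<leftarrow>cs. if P (r c) then n c else 0)"
      unfolding xs_def by (induction cs) auto
    then show ?thesis using cs by (simp add: sum_list_distinct_conv_sum_set)
  qed
  have box_count: "\<bar>real (length (filter (\<lambda>x. x \<in> box m) xs)) - N * prob (box m)\<bar> \<le> E"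
    if m: "m \<in> I" for m
  proof -
    define J where "J = {c\<in>I. \<forall>s. c s < m s}"
    have finJ: "finite J" using finI by (simp add: J_def)
    have "box m = (\<Union>c\<in>J. cell c)"
    proof (intro equalityI subsetI)
      fix x assume x: "x \<in> box m"
      have "(\<lambda>s. g s (x $ s)) \<in> J"
        using x m by (auto simp: box_def J_def I_def PiE_iff intro: less_trans)
      then show "x \<in> (\<Union>c\<in>J. cell c)" using x by (auto simp: box_def cell_def)
    qed (auto simp: cell_def box_def J_def)
    moreover have "prob (\<Union>c\<in>J. cell c) = (\<Sum>c\<in>J. prob (cell c))"
      using finJ by (intro finite_measure_finite_Union)
        (auto simp: disjoint_family_on_def cell_def fun_eq_iff)
    moreover have "length (filter (\<lambda>x. x \<in> box m) xs) = (\<Sum>c\<in>J. n c)"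
      unfolding cnt
    proof (rule sum.mono_neutral_cong_right)
      fix c
      show "(if r c \<in> box m then n c else 0) = n c" if "c \<in> J"
        using r[of c] that by (cases "n c = 0") (auto simp: J_def cell_def box_def)
    next
      show "\<forall>c\<in>I - J. (if r c \<in> box m then n c else 0) = 0"
        using r by (auto simp: J_def cell_def box_def)
    qed (use finI in \<open>auto simp: J_def\<close>)
    ultimately have "real (length (filter (\<lambda>x. x \<in> box m) xs)) - N * prob (box m)
        = (\<Sum>c\<in>J. real (n c) - N * prob (cell c))"
      by (simp add: sum_subtractf sum_distrib_left)
    also have "\<dots> = (\<Sum>c\<in>J. y c - X c)" using n by (intro sum.cong) (auto simp: J_def)
    finally show ?thesis using y(3) m by (simp add: J_def)
  qed
  have bound_I: "m \<in> I" if "\<And>s. m s \<le> 2 * N + 1" for m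
  proof -
    have "m s < 2 ^ K" for s using that[of s] K by linarith
    then show ?thesis by (simp add: I_def PiE_iff)
  qed
  have total: "\<bar>real (length xs) - real N\<bar> \<le> E"
  proof -
    \<comment> \<open>The whole cube is itself a union of cells, so its count controls the number of
      points.\<close>
    have "box (\<lambda>s. 2 * N + 1) = space \<mu>" unfolding box_def using le_imp_less_Suc[OF g_le] by simp
    moreover have "filter (\<lambda>x. x \<in> space \<mu>) xs = xs" using xs_space by (simp add: filter_id_conv)
    ultimately show ?thesis using box_count[OF bound_I, of "\<lambda>s. 2 * N + 1"] by (simp add: prob_space)
  qed
  have "\<bar>real (length (filter (\<lambda>x. x \<in> cbox 0 a) xs)) - N * prob (cbox 0 a)\<bar> \<le> E + 2 * real CARD('d)"
    if a: "a \<in> unit_cube" for a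
  proof -
    \<comment> \<open>\<open>ex s\<close> says that \<open>a $ s\<close> tops its level. The outer
      corner \<open>mp\<close> always includes the level of \<open>a $ s\<close>; the inner corner
      \<open>mm\<close> includes it only if it lies entirely below \<open>a $ s\<close>.\<close>
    define ex where "ex s \<longleftrightarrow> (\<forall>y. g s y = g s (a $ s) \<longrightarrow> y \<le> a $ s)" for s
    define mp where "mp s = g s (a $ s) + 1" for s
    define mm where "mm s = (if ex s then mp s else g s (a $ s))" for s
    define lev where "lev s = {x\<in>space \<mu>. g s (x $ s) = g s (a $ s)}" for s
    have lev_meas[measurable]: "lev s \<in> events" for s unfolding lev_def by measurable
    have A_sub: "cbox 0 a \<subseteq> space \<mu>"
      using a unfolding space by (simp add: subset_iff mem_box_cart) (meson order_trans)
    have A_meas[measurable]: "cbox 0 a \<in> events"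
      using A_sub unfolding sets space by (auto simp: sets_restrict_space_iff)
    have mm_sub: "box mm \<subseteq> cbox 0 a"
    proof
      fix x assume x: "x \<in> box mm"
      have "x $ s \<le> a $ s" for s
      proof (rule ccontr)
        assume "\<not> x $ s \<le> a $ s"
        then have lt: "a $ s < x $ s" by simp
        then have "g s (a $ s) \<le> g s (x $ s)" using monoD[OF g_mono, of "a $ s" "x $ s"] by simp
        moreover have "g s (x $ s) < mm s" using x by (simp add: box_def)
        ultimately show False using lt
          by (auto simp: mm_def mp_def ex_def less_Suc_eq_le not_le[symmetric] dest: order_antisym split: if_splits)
      qed
      then show "x \<in> cbox 0 a" using x by (auto simp: box_def space mem_box_cart)
    qed
    have mp_sub: "cbox 0 a \<subseteq> box mp"
      using A_sub monoD[OF g_mono] by (auto simp: box_def mp_def mem_box_cart less_Suc_eq_le)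
    have lev_prob: "prob (lev s) \<le> 2 / N" if "\<not> ex s" for s
    proof -
      have "measure (\<nu> s) {y. g s y = g s (a $ s)} = prob (lev s)"
        unfolding \<nu>_def lev_def by (subst measure_distr) (auto intro!: arg_cong[of _ _ prob])
      then show ?thesis using g_level[of s "a $ s"] that by (auto simp: ex_def)
    qed
    \<comment> \<open>The two boxes differ only on axes where \<open>ex s\<close> fails, and there
      the level has mass at most 2/N.\<close>
    have "box mp \<subseteq> box mm \<union> (\<Union>s\<in>{s. \<not> ex s}. lev s)"
      by (force simp: box_def mm_def mp_def lev_def less_Suc_eq)
    then have "prob (box mp) \<le> prob (box mm \<union> (\<Union>s\<in>{s. \<not> ex s}. lev s))"
      by (intro finite_measure_mono) auto
    also have "\<dots> \<le> prob (box mm) + prob (\<Union>s\<in>{s. \<not> ex s}. lev s)"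
      by (intro measure_Un_le) auto
    also have "prob (\<Union>s\<in>{s. \<not> ex s}. lev s) \<le> (\<Sum>s\<in>{s. \<not> ex s}. prob (lev s))"
      by (intro finite_measure_subadditive_finite) auto
    also have "\<dots> \<le> (\<Sum>s\<in>{s. \<not> ex s}. 2 / N)" using lev_prob by (intro sum_mono) auto
    also have "\<dots> \<le> (\<Sum>s\<in>(UNIV :: 'd set). 2 / N)" by (intro sum_mono2) auto
    finally have "prob (box mp) \<le> prob (box mm) + CARD('d) * (2 / N)" by simp
    then have "N * prob (box mp) \<le> N * (prob (box mm) + CARD('d) * (2 / N))"
      by (intro mult_left_mono) auto
    then have gap: "N * prob (box mp) \<le> N * prob (box mm) + 2 * CARD('d)"
      using N by (simp add: algebra_simps)
    have "N * prob (box mm) \<le> N * prob (cbox 0 a)" "N * prob (cbox 0 a) \<le> N * prob (box mp)"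
      using mm_sub mp_sub by (auto intro!: mult_left_mono finite_measure_mono)
    moreover have "length (filter (\<lambda>x. x \<in> box mm) xs) \<le> length (filter (\<lambda>x. x \<in> cbox 0 a) xs)"
      "length (filter (\<lambda>x. x \<in> cbox 0 a) xs) \<le> length (filter (\<lambda>x. x \<in> box mp) xs)"
      using mm_sub mp_sub by (auto intro!: length_filter_mono)
    moreover have "mm \<in> I" "mp \<in> I"
      using g_le by (auto intro!: bound_I simp: mm_def mp_def le_SucI)
    note box_count[OF this(1)] box_count[OF this(2)]
    ultimately show ?thesis using gap by linarith
  qed
  then show ?thesis using total xs_space space by (intro exI[of _ xs]) auto
qed

theorem theorem1:
  fixes \<mu> :: "(real ^ 'd) measure" and N :: nat
  assumes "prob_space \<mu>"
    and "sets \<mu> = sets (restrict_space borel unit_cube)"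
    and "N \<ge> 1"
  shows "\<exists>x :: nat \<Rightarrow> real ^ 'd. (\<forall>n\<in>{1..N}. x n \<in> unit_cube) \<and>
           star_discrepancy N x \<mu> \<le>
             63 * sqrt (real CARD('d)) *
               ((2 + log 2 (real N)) powr ((3 * real CARD('d) + 1) / 2) / real N)"
proof -
  define L where "L = 2 + log 2 (real N)"
  obtain k where k: "2 ^ k \<le> N" "N < 2 ^ (k + 1)"
    using ex_power_ivl1[of 2 N] assms(3) by auto
  \<comment> \<open>From \<open>N + 1 \<le> 2 ^ (k + 1)\<close> this is large enough for the levels,
    while \<open>k \<le> log 2 N\<close> keeps \<open>K\<close> below \<open>L\<close>.\<close>
  define K where "K = k + 2"
  have K: "2 * N + 2 \<le> 2 ^ K" using k by (simp add: K_def)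
  have "real (2 ^ k) \<le> real N" using k(1) of_nat_le_iff by blast
  then have k_le: "2 ^ k \<le> real N" by simp
  have "real k = log 2 (2 ^ k)" by simp
  also have "\<dots> \<le> log 2 (real N)"
    using k_le assms(3) by (intro log_mono) auto
  finally have KL: "real K \<le> L" by (simp add: K_def L_def)
  have L2: "2 \<le> L" using assms(3) by (simp add: L_def)
  define E where "E = 10 * real K ^ CARD('d) * (ln (2 * real ((2 ^ K) ^ CARD('d))) + 1/100)"
  obtain xs :: "(real ^ 'd) list" where xs: "set xs \<subseteq> unit_cube" "\<bar>real (length xs) - real N\<bar> \<le> E"
    "\<And>a. a \<in> unit_cube \<Longrightarrow>
      \<bar>real (length (filter (\<lambda>x. x \<in> cbox 0 a) xs)) - N * measure \<mu> (cbox 0 a)\<bar> \<le> E + 2 * real CARD('d)"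
    using balanced_points_exist[OF assms K] unfolding E_def by blast
  define zs where "zs = take N (xs @ replicate N 0)"
  have len: "length zs = N" by (simp add: zs_def)
  have "(0 :: real ^ 'd) \<in> unit_cube" by (simp add: mem_box_cart)
  then have zs_cube: "set zs \<subseteq> unit_cube"
    using xs(1) set_take_subset[of N "xs @ replicate N 0"] by (auto simp: zs_def)
  define x where "x n = zs ! (n - 1)" for n
  have "x n \<in> unit_cube" if "n \<in> {1..N}" for n
    using zs_cube that len by (auto simp: x_def intro!: subsetD[OF zs_cube] nth_mem)
  \<comment> \<open>One \<open>E\<close> comes from the box counts, the other from adjusting the
    length to \<open>N\<close>.\<close>
  moreover have "star_discrepancy N x \<mu> \<le> (2 * E + 2 * real CARD('d)) / N"
    unfolding star_discrepancy_def
  proof (rule cSUP_least[OF anchored_boxes_nonempty])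
    fix A :: "(real ^ 'd) set"
    assume "A \<in> anchored_boxes"
    then obtain a where a: "a \<in> unit_cube" "A = cbox 0 a" by (auto simp: anchored_boxes_def)
    define c where "c = (\<Sum>n=1..N. indicator A (x n) :: real)"
    have "c = real (length (filter (\<lambda>x. x \<in> A) zs))"
      unfolding c_def x_def using sum_indicator_nth[of A zs] len by simp
    then have "\<bar>c - N * measure \<mu> A\<bar> \<le> 2 * E + 2 * real CARD('d)"
      using filter_length_adjust[OF zs_def, of "\<lambda>x. x \<in> A"] xs(2) xs(3)[OF a(1)]
      unfolding a(2) by linarith
    moreover have "\<bar>1 / real N * c - measure \<mu> A\<bar> = \<bar>c - N * measure \<mu> A\<bar> / N"
    proof -
      have "1 / real N * c - measure \<mu> A = (c - N * measure \<mu> A) / N"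
        using assms(3) by (simp add: field_simps)
      then show ?thesis by simp
    qed
    ultimately show "\<bar>1 / real N * (\<Sum>n=1..N. indicator A (x n)) - measure \<mu> A\<bar>
        \<le> (2 * E + 2 * real CARD('d)) / N"
      unfolding c_def[symmetric] by (simp add: divide_right_mono)
  qed
  moreover have "(2 * E + 2 * real CARD('d)) / N
      \<le> 63 * sqrt (real CARD('d)) * L powr ((3 * real CARD('d) + 1) / 2) / N"
    using rounding_error_le_claimed_bound[OF _ L2 KL, of "CARD('d)"] by (intro divide_right_mono) (auto simp: E_def Suc_le_eq)
  ultimately show ?thesis unfolding L_def by (intro exI[of _ x]) auto
qed

end
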